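(* Let $E$ be a set of parameters, let $\{(X_s,\tau_s,E)\}_{s\in S}$ be a family of pairwise disjoint soft topological spaces and let $(Y,\tau',E)$ be a soft topological space, all over the same parameter set $E$. Let $(Y^{X_s},\tau_{s_p},E)$ be the pointwise soft function space of soft continuous mappings from $(X_s,\tau_s,E)$ to $(Y,\tau',E)$, and let $\left(Y^{\bigoplus_{s\in S}X_s},\tau_p,E\right)$ be the pointwise soft function space of soft continuous mappings from the soft topological sum $\bigoplus_{s\in S}(X_s,\tau_s,E)$ to $(Y,\tau',E)$. Then the mapping $$\nabla:\prod_{s\in S}\left(Y^{X_s},\tau_{s_p},E\right)\to\left(Y^{\bigoplus_{s\in S}X_s},\tau_p,E\right),$$ $\nabla(\{f_s\}_{s\in S})(x_\alpha)=f_{s_0}(x_\alpha)=(f_{s_0}(x))_\alpha$, where $s_0$ is the unique index with $x\in X_{s_0}$, is a soft homeomorphism, where the left-hand side carries the product soft topology.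
   Context: Soft sets: a soft set $(F,E)$ over a set $X$ is a map $F:E\to P(X)$ into the power set of $X$. Inclusions, unions and intersections of soft sets with the same parameter set $E$ are taken parameterwise: $(F,E)\subset(G,E)$ means $F(e)\subset G(e)$ for all $e\in E$, and $(F\cup G)(e)=F(e)\cup G(e)$, $(F\cap G)(e)=F(e)\cap G(e)$, similarly for arbitrary families. $\Phi$ is the soft set with $\Phi(e)=\varnothing$ for all $e\in E$, and $\widetilde X$ is the soft set with $\widetilde X(e)=X$ for all $e\in E$. Soft topology: a soft topology on $X$ (with parameter set $E$) is a collection $\tau$ of soft sets $(F,E)$ over $X$ that contains $\Phi$ and $\widetilde X$ and is closed under arbitrary unions and under intersections of two members; $(X,\tau,E)$ is then a soft topological space and the members of $\tau$ are its soft open sets. A subbase of $\tau$ is a subcollection whose finite intersections form a base, i.e. every member of $\tau$ is a union of such finite intersections. Soft points: for $x\in X$, $e\in E$, the soft point $x_e$ is the soft set with value $\{x\}$ at $e$ and $\varnothing$ at all other parameters; $x_e\in(F,E)$ means $x\in F(e)$. A soft set $(F,E)$ is a soft neighbourhood of $x_e$ if there is a soft open $(G,E)$ with $x_e\in(G,E)\subset(F,E)$. Soft mappings: a soft mapping $f=(f,1_E):(X,\tau,E)\to(Y,\tau',E)$ is given by a map $f:X\to Y$ together with the identity of $E$; it sends $x_e$ to $f(x)_e$, the image of $(F,E)$ is $e\mapsto f(F(e))$ and the preimage of $(G,E)$ is $e\mapsto f^{-1}(G(e))$. It is soft continuous if for every soft point $x_e$ of $X$ and every soft neighbourhood $(H,E)$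 of $f(x)_e$ there is a soft neighbourhood $(F,E)$ of $x_e$ with $f((F,E))\subset(H,E)$. A soft homeomorphism is a soft mapping given by a bijection such that it and its inverse are soft continuous. Product: the product of soft topological spaces $\{(Z_s,\eta_s,E)\}_{s\in S}$ is $\prod_{s\in S}Z_s$ with parameter set $E$ and the soft topology having as subbase all soft sets $e\mapsto F_{s_0}(e)\times\prod_{s\neq s_0}Z_s$, for $s_0\in S$ and $(F_{s_0},E)\in\eta_{s_0}$. Sum: for pairwise disjoint $X_s$ and a soft set $(F,E)$ over $\bigcup_{s\in S}X_s$ let $F|_{X_s}(e)=F(e)\cap X_s$. The soft topological sum $\bigoplus_{s\in S}(X_s,\tau_s,E)$ is $\bigcup_{s\in S}X_s$ with the soft topology consisting of those $(F,E)$ with $(F|_{X_s},E)\in\tau_s$ for every $s\in S$. Function space: for soft topological spaces $(X,\tau,E)$, $(Y,\tau',E)$, $Y^X$ denotes the set of all soft continuous mappings $(f,1_E):(X,\tau,E)\to(Y,\tau',E)$. For a soft point $x_\alpha$ of $X$ the evaluation map $e_{x_\alpha}:(Y^X,E)\to(Y,\tau',E)$ is the soft mapping given by $f\mapsto f(x)$ and the identity on $E$, so that $e_{x_\alpha}^{-1}(G,E)$ is the soft set $e\mapsto\{f\in Y^X: f(x)\in G(e)\}$ over $Y^X$. The pointwise soft topology $\tau_p$ on $Y^X$ is the soft topology with subbase $\{e_{x_\alpha}^{-1}(G,E): x\in X,\ \alpha\in E,\ (G,E)\in\tau'\}$, and $(Y^X,\tau_p,E)$ is called the pointwise soft function space.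 *)

theory Defs
  imports Main "HOL-Library.FuncSet" "HOL-Library.Disjoint_Sets"
begin

text \<open>
  A soft set over \<open>X\<close> with parameter set \<open>E\<close> is an extensional function on \<open>E\<close> with values in the
  power set of \<open>X\<close>, so that equality of soft sets is equality of functions.  A soft point \<open>x\<^sub>e\<close> is
  represented by \<open>x\<close> and \<open>e\<close> themselves, and \<open>x\<^sub>e \<in> (F,E)\<close> is written \<open>x \<in> F e\<close>.
\<close>

definition soft_sets :: "'e set \<Rightarrow> 'a set \<Rightarrow> ('e \<Rightarrow> 'a set) set" where
  "soft_sets E X = (E \<rightarrow>\<^sub>E Pow X)"

definition soft_subset :: "'e set \<Rightarrow> ('e \<Rightarrow> 'a set) \<Rightarrow> ('e \<Rightarrow> 'a set) \<Rightarrow> bool" where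
  "soft_subset E F G \<longleftrightarrow> (\<forall>e\<in>E. F e \<subseteq> G e)"

definition soft_null :: "'e set \<Rightarrow> 'e \<Rightarrow> 'a set" where
  "soft_null E = (\<lambda>e\<in>E. {})"

definition soft_absolute :: "'e set \<Rightarrow> 'a set \<Rightarrow> 'e \<Rightarrow> 'a set" where
  "soft_absolute E X = (\<lambda>e\<in>E. X)"

definition soft_int :: "'e set \<Rightarrow> ('e \<Rightarrow> 'a set) \<Rightarrow> ('e \<Rightarrow> 'a set) \<Rightarrow> 'e \<Rightarrow> 'a set" where
  "soft_int E F G = (\<lambda>e\<in>E. F e \<inter> G e)"

definition soft_Union :: "'e set \<Rightarrow> ('e \<Rightarrow> 'a set) set \<Rightarrow> 'e \<Rightarrow> 'a set" where
  "soft_Union E \<F> = (\<lambda>e\<in>E. \<Union>F\<in>\<F>. F e)"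

text \<open>Intersecting with \<open>X\<close> only matters for the empty family, whose intersection is the absolute soft set.\<close>

definition soft_Inter :: "'e set \<Rightarrow> 'a set \<Rightarrow> ('e \<Rightarrow> 'a set) set \<Rightarrow> 'e \<Rightarrow> 'a set" where
  "soft_Inter E X \<F> = (\<lambda>e\<in>E. X \<inter> (\<Inter>F\<in>\<F>. F e))"

definition soft_topology :: "'e set \<Rightarrow> 'a set \<Rightarrow> ('e \<Rightarrow> 'a set) set \<Rightarrow> bool" where
  "soft_topology E X \<tau> \<longleftrightarrow>
     \<tau> \<subseteq> soft_sets E X \<and>
     soft_null E \<in> \<tau> \<and> soft_absolute E X \<in> \<tau> \<and>
     (\<forall>\<F>. \<F> \<subseteq> \<tau> \<longrightarrow> soft_Union E \<F> \<in> \<tau>) \<and>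
     (\<forall>F\<in>\<tau>. \<forall>G\<in>\<tau>. soft_int E F G \<in> \<tau>)"

definition soft_finite_Inters ::
    "'e set \<Rightarrow> 'a set \<Rightarrow> ('e \<Rightarrow> 'a set) set \<Rightarrow> ('e \<Rightarrow> 'a set) set" where
  "soft_finite_Inters E X \<B> = {soft_Inter E X \<F> |\<F>. finite \<F> \<and> \<F> \<subseteq> \<B>}"

definition soft_subbase ::
    "'e set \<Rightarrow> 'a set \<Rightarrow> ('e \<Rightarrow> 'a set) set \<Rightarrow> ('e \<Rightarrow> 'a set) set \<Rightarrow> bool" where
  "soft_subbase E X \<tau> \<B> \<longleftrightarrow>
     \<B> \<subseteq> \<tau> \<and> (\<forall>F\<in>\<tau>. \<exists>\<W>. \<W> \<subseteq> soft_finite_Inters E X \<B> \<and> F = soft_Union E \<W>)"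

text \<open>
  The unique soft topology on \<open>X\<close> with a given subbase; see \<open>soft_topology_generated\<close>,
  \<open>soft_subbase_generated\<close> and \<open>soft_topology_eq_generated\<close> below.
\<close>

definition soft_generated ::
    "'e set \<Rightarrow> 'a set \<Rightarrow> ('e \<Rightarrow> 'a set) set \<Rightarrow> ('e \<Rightarrow> 'a set) set" where
  "soft_generated E X \<B> = {soft_Union E \<W> |\<W>. \<W> \<subseteq> soft_finite_Inters E X \<B>}"

definition soft_nbhd ::
    "'e set \<Rightarrow> 'a set \<Rightarrow> ('e \<Rightarrow> 'a set) set \<Rightarrow> 'a \<Rightarrow> 'e \<Rightarrow> ('e \<Rightarrow> 'a set) \<Rightarrow> bool" where
  "soft_nbhd E X \<tau> x e F \<longleftrightarrow>
     F \<in> soft_sets E X \<and> (\<exists>G\<in>\<tau>. x \<in> G e \<and> soft_subset E G F)"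

text \<open>A soft mapping \<open>(f, 1\<^sub>E)\<close> is represented by the function \<open>f\<close>.\<close>

definition soft_image :: "'e set \<Rightarrow> ('a \<Rightarrow> 'b) \<Rightarrow> ('e \<Rightarrow> 'a set) \<Rightarrow> 'e \<Rightarrow> 'b set" where
  "soft_image E f F = (\<lambda>e\<in>E. f ` F e)"

definition soft_vimage :: "'e set \<Rightarrow> 'a set \<Rightarrow> ('a \<Rightarrow> 'b) \<Rightarrow> ('e \<Rightarrow> 'b set) \<Rightarrow> 'e \<Rightarrow> 'a set" where
  "soft_vimage E X f G = (\<lambda>e\<in>E. {x \<in> X. f x \<in> G e})"

definition soft_continuous ::
    "'e set \<Rightarrow> 'a set \<Rightarrow> ('e \<Rightarrow> 'a set) set \<Rightarrow> 'b set \<Rightarrow> ('e \<Rightarrow> 'b set) set \<Rightarrow> ('a \<Rightarrow> 'b) \<Rightarrow> bool" where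
  "soft_continuous E X \<tau> Y \<tau>' f \<longleftrightarrow>
     f \<in> X \<rightarrow> Y \<and>
     (\<forall>x\<in>X. \<forall>e\<in>E. \<forall>H. soft_nbhd E Y \<tau>' (f x) e H \<longrightarrow>
        (\<exists>F. soft_nbhd E X \<tau> x e F \<and> soft_subset E (soft_image E f F) H))"

definition soft_homeomorphism ::
    "'e set \<Rightarrow> 'a set \<Rightarrow> ('e \<Rightarrow> 'a set) set \<Rightarrow> 'b set \<Rightarrow> ('e \<Rightarrow> 'b set) set \<Rightarrow> ('a \<Rightarrow> 'b) \<Rightarrow> bool" where
  "soft_homeomorphism E X \<tau> Y \<tau>' f \<longleftrightarrow>
     bij_betw f X Y \<and>
     soft_continuous E X \<tau> Y \<tau>' f \<and>
     soft_continuous E Y \<tau>' X \<tau> (inv_into X f)"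

definition soft_product_topology ::
    "'e set \<Rightarrow> 's set \<Rightarrow> ('s \<Rightarrow> 'z set) \<Rightarrow> ('s \<Rightarrow> ('e \<Rightarrow> 'z set) set) \<Rightarrow> ('e \<Rightarrow> ('s \<Rightarrow> 'z) set) set" where
  "soft_product_topology E S Z \<eta> =
     soft_generated E (Pi\<^sub>E S Z)
       {(\<lambda>e\<in>E. {z \<in> Pi\<^sub>E S Z. z s\<^sub>0 \<in> F e}) |s\<^sub>0 F. s\<^sub>0 \<in> S \<and> F \<in> \<eta> s\<^sub>0}"

definition soft_sum_topology ::
    "'e set \<Rightarrow> 's set \<Rightarrow> ('s \<Rightarrow> 'a set) \<Rightarrow> ('s \<Rightarrow> ('e \<Rightarrow> 'a set) set) \<Rightarrow> ('e \<Rightarrow> 'a set) set" where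
  "soft_sum_topology E S X \<tau> =
     {F \<in> soft_sets E (\<Union>s\<in>S. X s). \<forall>s\<in>S. (\<lambda>e\<in>E. F e \<inter> X s) \<in> \<tau> s}"

definition soft_maps ::
    "'e set \<Rightarrow> 'a set \<Rightarrow> ('e \<Rightarrow> 'a set) set \<Rightarrow> 'b set \<Rightarrow> ('e \<Rightarrow> 'b set) set \<Rightarrow> ('a \<Rightarrow> 'b) set" where
  "soft_maps E X \<tau> Y \<tau>' = {f \<in> X \<rightarrow>\<^sub>E Y. soft_continuous E X \<tau> Y \<tau>' f}"

definition soft_pointwise_topology ::
    "'e set \<Rightarrow> 'a set \<Rightarrow> ('e \<Rightarrow> 'a set) set \<Rightarrow> 'b set \<Rightarrow> ('e \<Rightarrow> 'b set) set
      \<Rightarrow> ('e \<Rightarrow> ('a \<Rightarrow> 'b) set) set" where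
  "soft_pointwise_topology E X \<tau> Y \<tau>' =
     soft_generated E (soft_maps E X \<tau> Y \<tau>')
       {soft_vimage E (soft_maps E X \<tau> Y \<tau>') (\<lambda>f. f x) G |x \<alpha> G. x \<in> X \<and> \<alpha> \<in> E \<and> G \<in> \<tau>'}"

definition soft_nabla :: "'s set \<Rightarrow> ('s \<Rightarrow> 'a set) \<Rightarrow> ('s \<Rightarrow> 'a \<Rightarrow> 'b) \<Rightarrow> 'a \<Rightarrow> 'b" where
  "soft_nabla S X f = (\<lambda>x \<in> (\<Union>s\<in>S. X s). f (THE s\<^sub>0. s\<^sub>0 \<in> S \<and> x \<in> X s\<^sub>0) x)"

lemma soft_nabla_apply:
  assumes "disjoint_family_on X S" "s\<^sub>0 \<in> S" "x \<in> X s\<^sub>0"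
  shows "soft_nabla S X f x = f s\<^sub>0 x"
proof -
  have "(THE s. s \<in> S \<and> x \<in> X s) = s\<^sub>0"
    using assms by (intro the_equality) (auto simp: disjoint_family_on_def)
  then show ?thesis
    using assms by (auto simp: soft_nabla_def)
qed

lemma soft_Inter_in_soft_sets: "soft_Inter E X \<F> \<in> soft_sets E X"
  by (auto simp: soft_Inter_def soft_sets_def)

lemma soft_topology_generated: "soft_topology E X (soft_generated E X \<B>)"
  unfolding soft_topology_def
proof (intro conjI allI impI ballI)
  show "soft_generated E X \<B> \<subseteq> soft_sets E X"
    unfolding soft_generated_def soft_sets_def soft_Union_def soft_finite_Inters_def soft_Inter_def
    by fastforce
  show "soft_null E \<in> soft_generated E X \<B>"
    unfolding soft_generated_def by (rule CollectI, rule exI[of _ "{}"]) (simp add: soft_null_def soft_Union_def)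
  have "soft_Inter E X {} \<in> soft_finite_Inters E X \<B>"
    unfolding soft_finite_Inters_def by blast
  then show "soft_absolute E X \<in> soft_generated E X \<B>"
    unfolding soft_generated_def
    by (intro CollectI exI[of _ "{soft_Inter E X {}}"])
       (simp_all add: soft_absolute_def soft_Union_def soft_Inter_def fun_eq_iff)
next
  fix \<F> assume sub: "\<F> \<subseteq> soft_generated E X \<B>"
  then have "\<forall>F\<in>\<F>. \<exists>\<W>. \<W> \<subseteq> soft_finite_Inters E X \<B> \<and> F = soft_Union E \<W>"
    unfolding soft_generated_def by blast
  then obtain w where w: "\<And>F. F \<in> \<F> \<Longrightarrow> w F \<subseteq> soft_finite_Inters E X \<B> \<and> F = soft_Union E (w F)"
    by metis
  have "F e = (\<Union>G\<in>w F. G e)" if "F \<in> \<F>" "e \<in> E" for F e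
    using w[OF that(1)] that(2) by (metis restrict_apply' soft_Union_def)
  then have "soft_Union E \<F> = soft_Union E (\<Union>F\<in>\<F>. w F)"
    unfolding soft_Union_def by (intro restrict_ext) auto
  moreover have "(\<Union>F\<in>\<F>. w F) \<subseteq> soft_finite_Inters E X \<B>"
    using w by blast
  ultimately show "soft_Union E \<F> \<in> soft_generated E X \<B>"
    unfolding soft_generated_def by blast
next
  fix F G assume "F \<in> soft_generated E X \<B>" "G \<in> soft_generated E X \<B>"
  then obtain V W where V: "V \<subseteq> soft_finite_Inters E X \<B>" "F = soft_Union E V"
    and W: "W \<subseteq> soft_finite_Inters E X \<B>" "G = soft_Union E W"
    unfolding soft_generated_def by blast
  let ?U = "(\<lambda>(A, B). soft_int E A B) ` (V \<times> W)"
  have "soft_int E A B \<in> soft_finite_Inters E X \<B>"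
    if A: "A \<in> soft_finite_Inters E X \<B>" and B: "B \<in> soft_finite_Inters E X \<B>" for A B
  proof -
    obtain P where P: "finite P" "P \<subseteq> \<B>" "A = soft_Inter E X P"
      using A unfolding soft_finite_Inters_def by blast
    obtain Q where Q: "finite Q" "Q \<subseteq> \<B>" "B = soft_Inter E X Q"
      using B unfolding soft_finite_Inters_def by blast
    have "soft_int E A B = soft_Inter E X (P \<union> Q)"
      unfolding P Q soft_int_def soft_Inter_def by (intro restrict_ext) auto
    then show ?thesis
      unfolding soft_finite_Inters_def using P Q by blast
  qed
  then have "?U \<subseteq> soft_finite_Inters E X \<B>"
    using V W by auto
  moreover have "soft_int E F G = soft_Union E ?U"
    unfolding V W soft_int_def soft_Union_def by (intro restrict_ext) auto
  ultimately show "soft_int E F G \<in> soft_generated E X \<B>"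
    unfolding soft_generated_def by blast
qed

lemma soft_subbase_generated:
  assumes "\<B> \<subseteq> soft_sets E X"
  shows "soft_subbase E X (soft_generated E X \<B>) \<B>"
  unfolding soft_subbase_def
proof (intro conjI subsetI)
  fix F assume F: "F \<in> \<B>"
  then have FE: "F \<in> E \<rightarrow>\<^sub>E Pow X"
    using assms by (auto simp: soft_sets_def)
  have "F = soft_Union E {soft_Inter E X {F}}"
  proof
    fix e show "F e = soft_Union E {soft_Inter E X {F}} e"
      using PiE_mem[OF FE, of e] PiE_arb[OF FE, of e]
      by (cases "e \<in> E") (auto simp: soft_Union_def soft_Inter_def)
  qed
  moreover have "soft_Inter E X {F} \<in> soft_finite_Inters E X \<B>"
    unfolding soft_finite_Inters_def using F by blast
  ultimately show "F \<in> soft_generated E X \<B>"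
    unfolding soft_generated_def by blast
next
  show "\<forall>F\<in>soft_generated E X \<B>. \<exists>\<W>\<subseteq>soft_finite_Inters E X \<B>. F = soft_Union E \<W>"
    unfolding soft_generated_def by blast
qed

lemma soft_topology_eq_generated:
  assumes \<tau>: "soft_topology E X \<tau>" and \<B>: "soft_subbase E X \<tau> \<B>"
  shows "\<tau> = soft_generated E X \<B>"
proof
  show "\<tau> \<subseteq> soft_generated E X \<B>"
    using \<B> unfolding soft_subbase_def soft_generated_def by blast
  have "soft_Inter E X \<F> \<in> \<tau>" if "finite \<F>" "\<F> \<subseteq> \<B>" for \<F>
    using that
  proof (induction \<F>)
    case empty
    have "soft_Inter E X {} = soft_absolute E X"
      by (simp add: soft_Inter_def soft_absolute_def)
    then show ?case
      using \<tau> by (simp add: soft_topology_def)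
  next
    case (insert F \<F>)
    have "soft_Inter E X (insert F \<F>) = soft_int E F (soft_Inter E X \<F>)"
      unfolding soft_int_def soft_Inter_def by (intro restrict_ext) auto
    moreover have "F \<in> \<tau>"
      using insert \<B> by (auto simp: soft_subbase_def)
    ultimately show ?case
      using insert \<tau> by (simp add: soft_topology_def)
  qed
  then have "soft_finite_Inters E X \<B> \<subseteq> \<tau>"
    unfolding soft_finite_Inters_def by blast
  then show "soft_generated E X \<B> \<subseteq> \<tau>"
    using \<tau> unfolding soft_generated_def soft_topology_def by blast
qed

lemma soft_topology_sum:
  assumes "\<And>s. s \<in> S \<Longrightarrow> soft_topology E (X s) (\<tau> s)"
  shows "soft_topology E (\<Union>s\<in>S. X s) (soft_sum_topology E S X \<tau>)"
  unfolding soft_topology_def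
proof (intro conjI allI impI ballI)
  show "soft_sum_topology E S X \<tau> \<subseteq> soft_sets E (\<Union>s\<in>S. X s)"
    by (auto simp: soft_sum_topology_def)
next
  have "(\<lambda>e\<in>E. soft_null E e \<inter> X s) = soft_null E" for s
    unfolding soft_null_def by (intro restrict_ext) auto
  then show "soft_null E \<in> soft_sum_topology E S X \<tau>"
    using assms by (auto simp: soft_sum_topology_def soft_topology_def soft_sets_def soft_null_def)
next
  have "(\<lambda>e\<in>E. soft_absolute E (\<Union>s\<in>S. X s) e \<inter> X s) = soft_absolute E (X s)" if "s \<in> S" for s
    using that unfolding soft_absolute_def by (intro restrict_ext) auto
  then show "soft_absolute E (\<Union>s\<in>S. X s) \<in> soft_sum_topology E S X \<tau>"
    using assms by (auto simp: soft_sum_topology_def soft_topology_def soft_sets_def soft_absolute_def)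
next
  fix \<F> assume sub: "\<F> \<subseteq> soft_sum_topology E S X \<tau>"
  have "(\<lambda>e\<in>E. soft_Union E \<F> e \<inter> X s) \<in> \<tau> s" if s: "s \<in> S" for s
  proof -
    have "(\<lambda>e\<in>E. soft_Union E \<F> e \<inter> X s) = soft_Union E ((\<lambda>F. \<lambda>e\<in>E. F e \<inter> X s) ` \<F>)"
      unfolding soft_Union_def by (intro restrict_ext) auto
    moreover have "(\<lambda>F. \<lambda>e\<in>E. F e \<inter> X s) ` \<F> \<subseteq> \<tau> s"
      using sub s by (auto simp: soft_sum_topology_def)
    ultimately show ?thesis
      using assms[OF s] by (simp add: soft_topology_def)
  qed
  moreover have "soft_Union E \<F> \<in> soft_sets E (\<Union>s\<in>S. X s)"
    using sub unfolding soft_sum_topology_def soft_sets_def soft_Union_def by fastforce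
  ultimately show "soft_Union E \<F> \<in> soft_sum_topology E S X \<tau>"
    by (simp add: soft_sum_topology_def)
next
  fix F G assume FG: "F \<in> soft_sum_topology E S X \<tau>" "G \<in> soft_sum_topology E S X \<tau>"
  have "(\<lambda>e\<in>E. soft_int E F G e \<inter> X s) \<in> \<tau> s" if s: "s \<in> S" for s
  proof -
    have "(\<lambda>e\<in>E. soft_int E F G e \<inter> X s) = soft_int E (\<lambda>e\<in>E. F e \<inter> X s) (\<lambda>e\<in>E. G e \<inter> X s)"
      unfolding soft_int_def by (intro restrict_ext) auto
    then show ?thesis
      using assms[OF s] FG s by (simp add: soft_topology_def soft_sum_topology_def)
  qed
  moreover have "soft_int E F G \<in> soft_sets E (\<Union>s\<in>S. X s)"
    using FG unfolding soft_sum_topology_def soft_sets_def soft_int_def by fastforce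
  ultimately show "soft_int E F G \<in> soft_sum_topology E S X \<tau>"
    by (simp add: soft_sum_topology_def)
qed

end

theory Submission
  imports Defs
begin

text \<open>
  The statement is the universal properties of the sum, the product and the pointwise topology
  put together.  A soft continuous map out of a sum is the same thing as a family of soft
  continuous maps out of the disjoint summands (\<open>soft_continuous_sum_iff\<close>), and gluing a family is
  \<open>\<nabla>\<close>, with inverse \<open>g \<mapsto> (g|X\<^sub>s)\<^sub>s\<close>; this gives the bijection.  For continuity, a map into a
  pointwise function space is soft continuous as soon as its composites with all evaluations are
  (\<open>soft_continuous_into_pointwise\<close>), and a map into a product is so as soon as its components
  are (\<open>soft_continuous_into_product\<close>).  For \<open>x \<in> X\<^sub>s\<close>, evaluation at \<open>x\<close> after \<open>\<nabla>\<close> is the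
  projection to the factor \<open>s\<close> followed by evaluation at \<open>x\<close>, while evaluation at \<open>x\<close> after the
  component \<open>s\<close> of the inverse is evaluation at \<open>x\<close> on the sum.  All of these are soft continuous.

  The universal properties rest on two facts: soft continuity, which is defined by neighbourhoods
  of soft points, amounts to openness of preimages of soft open sets (\<open>soft_continuous_iff\<close>), and
  it is enough to test this on a subbase (\<open>soft_continuous_generated\<close>).
\<close>

section \<open>Soft continuity and preimages of soft open sets\<close>

lemma soft_open_subset_carrier:
  assumes "soft_topology E X \<tau>" "F \<in> \<tau>" "e \<in> E"
  shows "F e \<subseteq> X"
  using assms by (auto simp: soft_topology_def soft_sets_def)

text \<open>
  For the nontrivial direction, the preimage of \<open>G\<close> is recovered as the union of all soft open
  sets inside it: the definition of continuity at \<open>x\<^sub>e\<close>, applied to \<open>G\<close> itself, places every soft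
  point of the preimage in one of them.
\<close>

lemma soft_continuous_iff:
  assumes \<tau>: "soft_topology E X \<tau>" and \<tau>': "soft_topology E Y \<tau>'"
  shows "soft_continuous E X \<tau> Y \<tau>' f \<longleftrightarrow>
    f \<in> X \<rightarrow> Y \<and> (\<forall>G\<in>\<tau>'. soft_vimage E X f G \<in> \<tau>)"
proof (intro iffI conjI ballI)
  assume f: "soft_continuous E X \<tau> Y \<tau>' f"
  then show "f \<in> X \<rightarrow> Y"
    by (simp add: soft_continuous_def)
  fix G assume G: "G \<in> \<tau>'"
  define \<U> where "\<U> = {U \<in> \<tau>. \<forall>e\<in>E. U e \<subseteq> {x \<in> X. f x \<in> G e}}"
  have "x \<in> (\<Union>U\<in>\<U>. U e)" if x: "x \<in> X" "f x \<in> G e" and e: "e \<in> E" for x e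
  proof -
    have "soft_nbhd E Y \<tau>' (f x) e G"
      using G \<tau>' x by (auto simp: soft_nbhd_def soft_subset_def soft_topology_def)
    then obtain F where F: "soft_nbhd E X \<tau> x e F" "soft_subset E (soft_image E f F) G"
      using f x e unfolding soft_continuous_def by blast
    then obtain U where U: "U \<in> \<tau>" "x \<in> U e" "soft_subset E U F"
      by (auto simp: soft_nbhd_def)
    have "U d \<subseteq> {x \<in> X. f x \<in> G d}" if "d \<in> E" for d
      using that U(3) F(2) soft_open_subset_carrier[OF \<tau> U(1) that]
      by (simp add: soft_subset_def soft_image_def) blast
    then show ?thesis
      using U by (auto simp: \<U>_def)
  qed
  then have "soft_vimage E X f G = soft_Union E \<U>"
    unfolding soft_vimage_def soft_Union_def
    by (intro restrict_ext) (auto simp: \<U>_def)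
  moreover have "soft_Union E \<U> \<in> \<tau>"
    using \<tau> by (auto simp: soft_topology_def \<U>_def)
  ultimately show "soft_vimage E X f G \<in> \<tau>"
    by simp
next
  assume *: "f \<in> X \<rightarrow> Y \<and> (\<forall>G\<in>\<tau>'. soft_vimage E X f G \<in> \<tau>)"
  show "soft_continuous E X \<tau> Y \<tau>' f"
    unfolding soft_continuous_def
  proof (intro conjI ballI allI impI)
    fix x e H assume x: "x \<in> X" and e: "e \<in> E" and H: "soft_nbhd E Y \<tau>' (f x) e H"
    then obtain G where G: "G \<in> \<tau>'" "f x \<in> G e" "soft_subset E G H"
      by (auto simp: soft_nbhd_def)
    have "soft_nbhd E X \<tau> x e (soft_vimage E X f G)"
      unfolding soft_nbhd_def
    proof (intro conjI bexI)
      show "soft_vimage E X f G \<in> soft_sets E X"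
        by (auto simp: soft_vimage_def soft_sets_def)
      show "soft_vimage E X f G \<in> \<tau>"
        using * G by blast
    qed (use x e G in \<open>auto simp: soft_vimage_def soft_subset_def\<close>)
    moreover have "soft_subset E (soft_image E f (soft_vimage E X f G)) H"
      using G by (auto simp: soft_subset_def soft_image_def soft_vimage_def)
    ultimately show "\<exists>F. soft_nbhd E X \<tau> x e F \<and> soft_subset E (soft_image E f F) H"
      by blast
  qed (use * in blast)
qed

lemma soft_continuous_cong:
  assumes "\<And>x. x \<in> X \<Longrightarrow> f x = g x"
    and \<tau>: "soft_topology E X \<tau>" and \<tau>': "soft_topology E Y \<tau>'"
  shows "soft_continuous E X \<tau> Y \<tau>' f \<longleftrightarrow> soft_continuous E X \<tau> Y \<tau>' g"
proof -
  have "soft_vimage E X f G = soft_vimage E X g G" for G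
    using assms(1) unfolding soft_vimage_def by (intro restrict_ext) auto
  moreover have "f \<in> X \<rightarrow> Y \<longleftrightarrow> g \<in> X \<rightarrow> Y"
    using assms(1) by (auto simp: Pi_iff)
  ultimately show ?thesis
    by (simp add: soft_continuous_iff[OF \<tau> \<tau>'])
qed

lemma soft_continuous_compose:
  assumes \<tau>: "soft_topology E X \<tau>" and \<tau>': "soft_topology E Y \<tau>'" and \<tau>'': "soft_topology E Z \<tau>''"
    and f: "soft_continuous E X \<tau> Y \<tau>' f" and g: "soft_continuous E Y \<tau>' Z \<tau>'' g"
  shows "soft_continuous E X \<tau> Z \<tau>'' (\<lambda>x. g (f x))"
proof -
  have fY: "f \<in> X \<rightarrow> Y" and gZ: "g \<in> Y \<rightarrow> Z"
    using f g by (auto simp: soft_continuous_def)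
  have "soft_vimage E X (\<lambda>x. g (f x)) G = soft_vimage E X f (soft_vimage E Y g G)" for G
    using fY unfolding soft_vimage_def by (intro restrict_ext) auto
  then show ?thesis
    using f g fY gZ by (auto simp: soft_continuous_iff[OF \<tau> \<tau>'] soft_continuous_iff[OF \<tau>' \<tau>'']
      soft_continuous_iff[OF \<tau> \<tau>''])
qed

lemma soft_homeomorphismI:
  assumes \<tau>: "soft_topology E X \<tau>" and \<tau>': "soft_topology E Y \<tau>'"
    and f: "soft_continuous E X \<tau> Y \<tau>' f" and g: "soft_continuous E Y \<tau>' X \<tau> g"
    and gf: "\<And>x. x \<in> X \<Longrightarrow> g (f x) = x" and fg: "\<And>y. y \<in> Y \<Longrightarrow> f (g y) = y"
  shows "soft_homeomorphism E X \<tau> Y \<tau>' f"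
proof -
  have fY: "f \<in> X \<rightarrow> Y" and gX: "g \<in> Y \<rightarrow> X"
    using f g by (auto simp: soft_continuous_def)
  have bij: "bij_betw f X Y"
    by (rule bij_betwI[OF fY gX gf fg])
  have "inv_into X f y = g y" if "y \<in> Y" for y
    using that bij gX fg by (intro inv_into_f_eq) (auto simp: bij_betw_def)
  then show ?thesis
    unfolding soft_homeomorphism_def
    using bij f g soft_continuous_cong[OF _ \<tau>' \<tau>, of "inv_into X f" g] by blast
qed

section \<open>Soft topologies generated by a subbase\<close>

text \<open>Preimages commute with finite intersections and with unions, so openness passes from the
  subbase to the generated topology.\<close>

lemma soft_continuous_generated:
  assumes \<tau>: "soft_topology E X \<tau>" and f: "f \<in> X \<rightarrow> Y"
    and \<B>: "\<And>G. G \<in> \<B> \<Longrightarrow> soft_vimage E X f G \<in> \<tau>"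
  shows "soft_continuous E X \<tau> Y (soft_generated E Y \<B>) f"
proof -
  have Int: "soft_vimage E X f (soft_Inter E Y \<F>) \<in> \<tau>" if "finite \<F>" "\<F> \<subseteq> \<B>" for \<F>
    using that
  proof (induction \<F>)
    case empty
    have "soft_vimage E X f (soft_Inter E Y {}) = soft_absolute E X"
      using f unfolding soft_vimage_def soft_Inter_def soft_absolute_def
      by (intro restrict_ext) auto
    then show ?case
      using \<tau> by (simp add: soft_topology_def)
  next
    case (insert F \<F>)
    have "soft_vimage E X f (soft_Inter E Y (insert F \<F>)) =
        soft_int E (soft_vimage E X f F) (soft_vimage E X f (soft_Inter E Y \<F>))"
      unfolding soft_vimage_def soft_Inter_def soft_int_def by (intro restrict_ext) auto
    then show ?case
      using insert \<tau> \<B> by (simp add: soft_topology_def)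
  qed
  have "soft_vimage E X f G \<in> \<tau>" if G: "G \<in> soft_generated E Y \<B>" for G
  proof -
    obtain \<W> where \<W>: "\<W> \<subseteq> soft_finite_Inters E Y \<B>" "G = soft_Union E \<W>"
      using G by (auto simp: soft_generated_def)
    have vimage_Union: "soft_vimage E X f G = soft_Union E (soft_vimage E X f ` \<W>)"
      unfolding \<W>(2) soft_vimage_def soft_Union_def by (intro restrict_ext) auto
    have "soft_vimage E X f F \<in> \<tau>" if "F \<in> \<W>" for F
      using \<W>(1) that Int unfolding soft_finite_Inters_def by blast
    then have "soft_vimage E X f ` \<W> \<subseteq> \<tau>"
      by blast
    with vimage_Union show ?thesis
      using \<tau> by (simp add: soft_topology_def)
  qed
  then show ?thesis
    using f by (simp add: soft_continuous_iff[OF \<tau> soft_topology_generated])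
qed

lemma soft_generated_base:
  assumes "F \<in> \<B>" "F \<in> soft_sets E X"
  shows "F \<in> soft_generated E X \<B>"
proof -
  \<comment> \<open>Only \<open>F\<close> itself is known to be a soft set over \<open>X\<close>, so the subbase is first cut down to
    \<open>{F}\<close>; generation is monotone.\<close>
  have "F \<in> soft_generated E X {F}"
    using soft_subbase_generated[of "{F}" E X] assms by (simp add: soft_subbase_def)
  moreover have "soft_finite_Inters E X {F} \<subseteq> soft_finite_Inters E X \<B>"
    using assms(1) unfolding soft_finite_Inters_def by blast
  ultimately show ?thesis
    unfolding soft_generated_def by blast
qed

section \<open>The product and pointwise topologies\<close>

lemma soft_topology_product: "soft_topology E (Pi\<^sub>E S Z) (soft_product_topology E S Z \<eta>)"
  unfolding soft_product_topology_def by (rule soft_topology_generated)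

lemma soft_topology_pointwise:
  "soft_topology E (soft_maps E X \<tau> Y \<tau>') (soft_pointwise_topology E X \<tau> Y \<tau>')"
  unfolding soft_pointwise_topology_def by (rule soft_topology_generated)

lemma soft_continuous_projection:
  assumes \<eta>: "soft_topology E (Z s) (\<eta> s)" and s: "s \<in> S"
  shows "soft_continuous E (Pi\<^sub>E S Z) (soft_product_topology E S Z \<eta>) (Z s) (\<eta> s) (\<lambda>z. z s)"
proof -
  have "soft_vimage E (Pi\<^sub>E S Z) (\<lambda>z. z s) F \<in> soft_product_topology E S Z \<eta>" if "F \<in> \<eta> s" for F
    unfolding soft_product_topology_def
  proof (rule soft_generated_base)
    show "soft_vimage E (Pi\<^sub>E S Z) (\<lambda>z. z s) F \<in> soft_sets E (Pi\<^sub>E S Z)"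
      by (auto simp: soft_vimage_def soft_sets_def)
  qed (use s that in \<open>auto simp: soft_vimage_def\<close>)
  moreover have "(\<lambda>z. z s) \<in> Pi\<^sub>E S Z \<rightarrow> Z s"
    using s by auto
  ultimately show ?thesis
    by (simp add: soft_continuous_iff[OF soft_topology_product \<eta>])
qed

lemma soft_continuous_into_product:
  assumes \<tau>: "soft_topology E X \<tau>" and \<eta>: "\<And>s. s \<in> S \<Longrightarrow> soft_topology E (Z s) (\<eta> s)"
    and f: "f \<in> X \<rightarrow> extensional S"
    and fs: "\<And>s. s \<in> S \<Longrightarrow> soft_continuous E X \<tau> (Z s) (\<eta> s) (\<lambda>x. f x s)"
  shows "soft_continuous E X \<tau> (Pi\<^sub>E S Z) (soft_product_topology E S Z \<eta>) f"
proof -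
  have fZ: "f x \<in> Pi\<^sub>E S Z" if "x \<in> X" for x
    using f fs that by (auto simp: soft_continuous_def PiE_def)
  show ?thesis
    unfolding soft_product_topology_def
  proof (rule soft_continuous_generated[OF \<tau>])
    fix G assume "G \<in> {\<lambda>e\<in>E. {z \<in> Pi\<^sub>E S Z. z s \<in> F e} |s F. s \<in> S \<and> F \<in> \<eta> s}"
    then obtain s F where s: "s \<in> S" "F \<in> \<eta> s" and G: "G = (\<lambda>e\<in>E. {z \<in> Pi\<^sub>E S Z. z s \<in> F e})"
      by blast
    have "soft_vimage E X f G = soft_vimage E X (\<lambda>x. f x s) F"
      using fZ unfolding G soft_vimage_def by (intro restrict_ext) auto
    then show "soft_vimage E X f G \<in> \<tau>"
      using fs[OF s(1)] s by (simp add: soft_continuous_iff[OF \<tau> \<eta>])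
  qed (use fZ in blast)
qed

lemma soft_continuous_evaluation:
  assumes \<tau>': "soft_topology E Y \<tau>'" and x: "x \<in> X"
  shows "soft_continuous E (soft_maps E X \<tau> Y \<tau>') (soft_pointwise_topology E X \<tau> Y \<tau>') Y \<tau>' (\<lambda>f. f x)"
proof (cases "E = {}")
  \<comment> \<open>The subbase of the pointwise topology is indexed by soft points, of which there are none
    when there are no parameters.\<close>
  case True
  then show ?thesis
    using x by (auto simp: soft_continuous_def soft_maps_def)
next
  case False
  have "soft_vimage E (soft_maps E X \<tau> Y \<tau>') (\<lambda>f. f x) G \<in> soft_pointwise_topology E X \<tau> Y \<tau>'"
    if "G \<in> \<tau>'" for G
    unfolding soft_pointwise_topology_def
  proof (rule soft_generated_base)
    show "soft_vimage E (soft_maps E X \<tau> Y \<tau>') (\<lambda>f. f x) G \<in> soft_sets E (soft_maps E X \<tau> Y \<tau>')"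
      by (auto simp: soft_vimage_def soft_sets_def)
  qed (use False x that in blast)
  moreover have "(\<lambda>f. f x) \<in> soft_maps E X \<tau> Y \<tau>' \<rightarrow> Y"
    using x by (auto simp: soft_maps_def)
  ultimately show ?thesis
    by (simp add: soft_continuous_iff[OF soft_topology_pointwise \<tau>'])
qed

lemma soft_continuous_into_pointwise:
  assumes \<sigma>: "soft_topology E Z \<sigma>" and \<tau>': "soft_topology E Y \<tau>'"
    and f: "f \<in> Z \<rightarrow> soft_maps E X \<tau> Y \<tau>'"
    and fx: "\<And>x. x \<in> X \<Longrightarrow> soft_continuous E Z \<sigma> Y \<tau>' (\<lambda>z. f z x)"
  shows "soft_continuous E Z \<sigma> (soft_maps E X \<tau> Y \<tau>') (soft_pointwise_topology E X \<tau> Y \<tau>') f"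
  unfolding soft_pointwise_topology_def
proof (rule soft_continuous_generated[OF \<sigma> f])
  let ?M = "soft_maps E X \<tau> Y \<tau>'"
  fix H assume "H \<in> {soft_vimage E ?M (\<lambda>f. f x) G |x \<alpha> G. x \<in> X \<and> \<alpha> \<in> E \<and> G \<in> \<tau>'}"
  then obtain x G where x: "x \<in> X" "G \<in> \<tau>'" and H: "H = soft_vimage E ?M (\<lambda>f. f x) G"
    by blast
  have "soft_vimage E Z f H = soft_vimage E Z (\<lambda>z. f z x) G"
    using f unfolding H soft_vimage_def by (intro restrict_ext) auto
  then show "soft_vimage E Z f H \<in> \<sigma>"
    using fx[OF x(1)] x by (simp add: soft_continuous_iff[OF \<sigma> \<tau>'])
qed

section \<open>Maps out of a soft topological sum\<close>

text \<open>
  A soft set over the sum is open iff its trace on each summand is, and the trace on \<open>X s\<close> of the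
  preimage of \<open>G\<close> under \<open>f\<close> is the preimage of \<open>G\<close> under the restriction of \<open>f\<close>.
\<close>

lemma soft_continuous_sum_iff:
  assumes \<tau>: "\<And>s. s \<in> S \<Longrightarrow> soft_topology E (X s) (\<tau> s)" and \<tau>': "soft_topology E Y \<tau>'"
  shows "soft_continuous E (\<Union>s\<in>S. X s) (soft_sum_topology E S X \<tau>) Y \<tau>' f \<longleftrightarrow>
    (\<forall>s\<in>S. soft_continuous E (X s) (\<tau> s) Y \<tau>' f)"
proof -
  have trace: "(\<lambda>e\<in>E. soft_vimage E (\<Union>s\<in>S. X s) f G e \<inter> X s) = soft_vimage E (X s) f G"
    if "s \<in> S" for s G
    using that unfolding soft_vimage_def by (intro restrict_ext) auto
  have "soft_vimage E (\<Union>s\<in>S. X s) f G \<in> soft_sum_topology E S X \<tau> \<longleftrightarrow>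
      (\<forall>s\<in>S. soft_vimage E (X s) f G \<in> \<tau> s)" for G
  proof -
    have "soft_vimage E (\<Union>s\<in>S. X s) f G \<in> soft_sets E (\<Union>s\<in>S. X s)"
      by (auto simp: soft_vimage_def soft_sets_def)
    then show ?thesis
      by (simp add: soft_sum_topology_def trace)
  qed
  moreover have "f \<in> (\<Union>s\<in>S. X s) \<rightarrow> Y \<longleftrightarrow> (\<forall>s\<in>S. f \<in> X s \<rightarrow> Y)"
    by auto
  moreover have "soft_continuous E (X s) (\<tau> s) Y \<tau>' f \<longleftrightarrow>
      f \<in> X s \<rightarrow> Y \<and> (\<forall>G\<in>\<tau>'. soft_vimage E (X s) f G \<in> \<tau> s)" if "s \<in> S" for s
    using \<tau>[OF that] \<tau>' by (rule soft_continuous_iff)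
  ultimately show ?thesis
    using soft_continuous_iff[OF soft_topology_sum[of S E X \<tau>, OF \<tau>] \<tau>', of f] by auto
qed

text \<open>
  By disjointness a glued family agrees on \<open>X s\<close> with its own member \<open>f s\<close>, so each restriction of
  \<open>\<nabla> f\<close> inherits continuity.
\<close>

lemma soft_nabla_in_soft_maps:
  assumes \<tau>: "\<And>s. s \<in> S \<Longrightarrow> soft_topology E (X s) (\<tau> s)" and \<tau>': "soft_topology E Y \<tau>'"
    and disj: "disjoint_family_on X S"
    and f: "f \<in> (\<Pi>\<^sub>E s\<in>S. soft_maps E (X s) (\<tau> s) Y \<tau>')"
  shows "soft_nabla S X f \<in> soft_maps E (\<Union>s\<in>S. X s) (soft_sum_topology E S X \<tau>) Y \<tau>'"
proof -
  have "soft_continuous E (X s) (\<tau> s) Y \<tau>' (soft_nabla S X f)" if s: "s \<in> S" for s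
  proof -
    have "f s \<in> soft_maps E (X s) (\<tau> s) Y \<tau>'"
      using f s by (rule PiE_mem)
    then show ?thesis
      using soft_continuous_cong[OF soft_nabla_apply[OF disj s] \<tau>[OF s] \<tau>']
      by (auto simp: soft_maps_def)
  qed
  then have "soft_continuous E (\<Union>s\<in>S. X s) (soft_sum_topology E S X \<tau>) Y \<tau>' (soft_nabla S X f)"
    using soft_continuous_sum_iff[of S E X \<tau>, OF \<tau> \<tau>'] by blast
  moreover have "soft_nabla S X f \<in> extensional (\<Union>s\<in>S. X s)"
    by (simp add: soft_nabla_def)
  ultimately show ?thesis
    by (simp add: soft_maps_def soft_continuous_def PiE_def)
qed

lemma restrict_in_soft_maps:
  assumes \<tau>: "\<And>s. s \<in> S \<Longrightarrow> soft_topology E (X s) (\<tau> s)" and \<tau>': "soft_topology E Y \<tau>'"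
    and g: "g \<in> soft_maps E (\<Union>s\<in>S. X s) (soft_sum_topology E S X \<tau>) Y \<tau>'" and s: "s \<in> S"
  shows "restrict g (X s) \<in> soft_maps E (X s) (\<tau> s) Y \<tau>'"
proof -
  have "soft_continuous E (X s) (\<tau> s) Y \<tau>' g"
    using g s soft_continuous_sum_iff[of S E X \<tau>, OF \<tau> \<tau>'] by (simp add: soft_maps_def)
  then have "soft_continuous E (X s) (\<tau> s) Y \<tau>' (restrict g (X s))"
    using soft_continuous_cong[OF _ \<tau>[OF s] \<tau>', of "restrict g (X s)" g] by simp
  then show ?thesis
    by (simp add: soft_maps_def soft_continuous_def PiE_def)
qed

section \<open>The exponential law for sums\<close>

theorem theorem5:
  fixes E :: "'e set" and S :: "'s set"
    and X :: "'s \<Rightarrow> 'a set" and \<tau> :: "'s \<Rightarrow> ('e \<Rightarrow> 'a set) set"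
    and Y :: "'b set" and \<tau>' :: "('e \<Rightarrow> 'b set) set"
  assumes "\<And>s. s \<in> S \<Longrightarrow> soft_topology E (X s) (\<tau> s)"
    and "disjoint_family_on X S"
    and "soft_topology E Y \<tau>'"
  shows "soft_homeomorphism E
      (\<Pi>\<^sub>E s\<in>S. soft_maps E (X s) (\<tau> s) Y \<tau>')
      (soft_product_topology E S
        (\<lambda>s. soft_maps E (X s) (\<tau> s) Y \<tau>')
        (\<lambda>s. soft_pointwise_topology E (X s) (\<tau> s) Y \<tau>'))
      (soft_maps E (\<Union>s\<in>S. X s) (soft_sum_topology E S X \<tau>) Y \<tau>')
      (soft_pointwise_topology E (\<Union>s\<in>S. X s) (soft_sum_topology E S X \<tau>) Y \<tau>')
      (soft_nabla S X)"
proof -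
  let ?U = "\<Union>s\<in>S. X s" and ?\<sigma> = "soft_sum_topology E S X \<tau>"
  let ?M = "\<lambda>s. soft_maps E (X s) (\<tau> s) Y \<tau>'" and ?\<tau>p = "\<lambda>s. soft_pointwise_topology E (X s) (\<tau> s) Y \<tau>'"
  let ?N = "soft_maps E ?U ?\<sigma> Y \<tau>'" and ?\<sigma>p = "soft_pointwise_topology E ?U ?\<sigma> Y \<tau>'"
  let ?r = "\<lambda>g. \<lambda>s\<in>S. restrict g (X s)"
  note \<tau> = assms(1) and disj = assms(2) and \<tau>' = assms(3)
  note nabla = soft_nabla_in_soft_maps[of S E X \<tau>, OF \<tau> \<tau>' disj]
  note restr = restrict_in_soft_maps[of S E X \<tau>, OF \<tau> \<tau>']
  show ?thesis
  proof (rule soft_homeomorphismI[where g = ?r, OF soft_topology_product soft_topology_pointwise])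
    show "soft_continuous E (Pi\<^sub>E S ?M) (soft_product_topology E S ?M ?\<tau>p) ?N ?\<sigma>p (soft_nabla S X)"
    proof (rule soft_continuous_into_pointwise[OF soft_topology_product \<tau>'])
      fix x assume "x \<in> ?U"
      then obtain s where s: "s \<in> S" "x \<in> X s"
        by blast
      have "soft_continuous E (Pi\<^sub>E S ?M) (soft_product_topology E S ?M ?\<tau>p) Y \<tau>' (\<lambda>f. f s x)"
        by (rule soft_continuous_compose[where g = "\<lambda>h. h x", OF soft_topology_product soft_topology_pointwise \<tau>'
              soft_continuous_projection[where Z = ?M and \<eta> = ?\<tau>p, OF soft_topology_pointwise s(1)]
              soft_continuous_evaluation[OF \<tau>' s(2)]])
      then show "soft_continuous E (Pi\<^sub>E S ?M) (soft_product_topology E S ?M ?\<tau>p) Y \<tau>'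
          (\<lambda>f. soft_nabla S X f x)"
        by (simp add: soft_nabla_apply[OF disj s])
    qed (use nabla in blast)
  next
    show "soft_continuous E ?N ?\<sigma>p (Pi\<^sub>E S ?M) (soft_product_topology E S ?M ?\<tau>p) ?r"
    proof (rule soft_continuous_into_product[OF soft_topology_pointwise soft_topology_pointwise])
      fix s assume s: "s \<in> S"
      have "soft_continuous E ?N ?\<sigma>p (?M s) (?\<tau>p s) (\<lambda>g. restrict g (X s))"
      proof (rule soft_continuous_into_pointwise[OF soft_topology_pointwise \<tau>'])
        fix x assume x: "x \<in> X s"
        then have "x \<in> ?U"
          using s by blast
        then have "soft_continuous E ?N ?\<sigma>p Y \<tau>' (\<lambda>g. g x)"
          by (rule soft_continuous_evaluation[OF \<tau>'])
        then show "soft_continuous E ?N ?\<sigma>p Y \<tau>' (\<lambda>g. restrict g (X s) x)"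
          using x by simp
      qed (use restr s in blast)
      then show "soft_continuous E ?N ?\<sigma>p (?M s) (?\<tau>p s) (\<lambda>g. ?r g s)"
        using s by simp
    qed auto
  next
    fix f assume f: "f \<in> Pi\<^sub>E S ?M"
    show "?r (soft_nabla S X f) = f"
    proof (rule extensionalityI[of _ S])
      fix s assume s: "s \<in> S"
      have "f s \<in> extensional (X s)"
        using PiE_mem[OF f s] by (simp add: soft_maps_def PiE_def)
      then have "restrict (soft_nabla S X f) (X s) = f s"
        using soft_nabla_apply[OF disj s] by (intro extensionalityI[of _ "X s"]) auto
      then show "?r (soft_nabla S X f) s = f s"
        using s by simp
    qed (use f in \<open>auto simp: PiE_def\<close>)
  next
    fix g assume g: "g \<in> ?N"
    show "soft_nabla S X (?r g) = g"
    proof (rule extensionalityI[of _ ?U])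
      fix x assume "x \<in> ?U"
      then obtain s where s: "s \<in> S" "x \<in> X s"
        by blast
      then show "soft_nabla S X (?r g) x = g x"
        by (simp add: soft_nabla_apply[OF disj s])
    qed (use g in \<open>auto simp: soft_nabla_def soft_maps_def PiE_def\<close>)
  qed
qed

end
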